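(* Let $\mathcal{A}\in\mathbb{R}^{n\times\cdots\times n}$ be an order $k$ tensor. If $\mathcal{A}$ is a sign nonsingular tensor, then ${\rm rank}_\boxplus(\widetilde{\mathcal{A}})=(n,\ldots,n)$ for every $\widetilde{\mathcal{A}}\in\mathcal{Q}(\mathcal{A})$, and ${\rm mr}(\mathcal{A})\ge n$.
   Context: For an order $k$ dimension $n$ tensor $\mathcal{A}=(a_{i_1\cdots i_k})$ and $x\in\mathbb{C}^n$, $\mathcal{A}x^{k-1}$ is the vector with $i$-th component $\sum_{i_2,\ldots,i_k}a_{ii_2\cdots i_k}x_{i_2}\cdots x_{i_k}$. The determinant ${\rm det}(\mathcal{A})$ is the resultant of the homogeneous system $\mathcal{A}x^{k-1}=0$; in particular ${\rm det}(\mathcal{A})=0$ iff $\mathcal{A}x^{k-1}=0$ has a nonzero complex solution. $\mathcal{A}$ is nonsingular if ${\rm det}(\mathcal{A})\neq0$. $\mathcal{Q}(\mathcal{A})$ is the set of real tensors with the same entrywise sign pattern as $\mathcal{A}$; $\mathcal{A}$ is sign nonsingular if every tensor in $\mathcal{Q}(\mathcal{A})$ is nonsingular. For $s\in[k]$, $r_s(\mathcal{A})$ is the dimension of the span of all mode-$s$ fibers $(a_{d_1\cdots d_{s-1}\,t\,d_{s+1}\cdots d_k})_{t=1}^{n}$ (over all choices of the other indices), and ${\rm rank}_\boxplus(\mathcal{A})=(r_1(\mathcal{A}),\ldots,r_k(\mathcal{A}))$. A rank one tensor is $\alpha_1\otimes\cdots\otimes\alpha_k$ with nonzero vectors $\alpha_j$,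 entries $(\alpha_1)_{i_1}\cdots(\alpha_k)_{i_k}$; ${\rm rank}$ is the smallest number of rank one tensors summing to the tensor, and ${\rm mr}(\mathcal{A})=\min\{{\rm rank}(\mathcal{B}):\mathcal{B}\in\mathcal{Q}(\mathcal{A})\}$. *)

theory Defs
  imports "HOL-Analysis.Analysis" "HOL-Library.Poly_Mapping"
    "HOL-Computational_Algebra.Factorial_Ring"
begin

(* A real tensor of order k and dimension n = CARD('n). Only its values at index lists of
   length k are meaningful; every definition below takes k and looks at such lists only. *)
type_synonym 'n tensor = "'n list \<Rightarrow> real"

definition tensor_apply :: "nat \<Rightarrow> 'n::finite tensor \<Rightarrow> complex ^ 'n \<Rightarrow> complex ^ 'n" where
  "tensor_apply k A x =
     (\<chi> i. \<Sum>js | length js = k - 1. of_real (A (i # js)) * (\<Prod>j\<leftarrow>js. x $ j))"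


section \<open>Resultant of n forms of degree d in n variables\<close>

(* The monomial x^a of degree d is given by its exponent function a, and a system of forms
   F_i = \<Sum>a. c (i, a) x^a (i in 'n) by its coefficient family c. *)

type_synonym 'n coeff_index = "'n \<times> ('n \<Rightarrow> nat)"

definition exponents :: "nat \<Rightarrow> ('n::finite \<Rightarrow> nat) set" where
  "exponents d = {a. (\<Sum>j\<in>UNIV. a j) = d}"

definition form_eval ::
  "nat \<Rightarrow> ('n::finite coeff_index \<Rightarrow> complex) \<Rightarrow> 'n \<Rightarrow> complex ^ 'n \<Rightarrow> complex" where
  "form_eval d c i x = (\<Sum>a\<in>exponents d. c (i, a) * (\<Prod>j\<in>UNIV. (x $ j) ^ a j))"

(* Polynomials over the complex numbers in variables from 'v: finitely supported coefficient
   functions on monomials, which are finitely supported exponent functions. *)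
type_synonym 'v cpoly = "('v \<Rightarrow>\<^sub>0 nat) \<Rightarrow>\<^sub>0 complex"

definition cpoly_vars :: "'v cpoly \<Rightarrow> 'v set" where
  "cpoly_vars P = (\<Union>m\<in>Poly_Mapping.keys P. Poly_Mapping.keys m)"

definition cpoly_eval :: "('v \<Rightarrow> complex) \<Rightarrow> 'v cpoly \<Rightarrow> complex" where
  "cpoly_eval c P =
     (\<Sum>m\<in>Poly_Mapping.keys P. Poly_Mapping.lookup P m *
        (\<Prod>v\<in>Poly_Mapping.keys m. c v ^ Poly_Mapping.lookup m v))"

(* The standard defining properties of the resultant (Cox, Little, O'Shea, Using Algebraic
   Geometry, Chapter 3, Theorem 2.3): it is the unique polynomial with integer coefficients in
   the coefficients of the forms that vanishes exactly at the systems with a nontrivial complex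
   zero, has the value 1 at the system x_i^d, and is irreducible over the complex numbers. *)
definition is_resultant :: "nat \<Rightarrow> 'n::finite coeff_index cpoly \<Rightarrow> bool" where
  "is_resultant d R \<longleftrightarrow>
     cpoly_vars R \<subseteq> UNIV \<times> exponents d \<and>
     (\<forall>m. Poly_Mapping.lookup R m \<in> \<int>) \<and>
     (\<forall>c. cpoly_eval c R = 0 \<longleftrightarrow> (\<exists>x. x \<noteq> 0 \<and> (\<forall>i. form_eval d c i x = 0))) \<and>
     cpoly_eval (\<lambda>(i, a). if a = (\<lambda>j. if j = i then d else 0) then 1 else 0) R = 1 \<and>
     irreducible R"

(* By the classical theorem quoted above, for d > 0 the polynomial R exists and is unique, so
   the value 0 is only a convention for the case d = 0. *)
definition resultant :: "nat \<Rightarrow> 'n::finite coeff_index cpoly" where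
  "resultant d =
     (if \<exists>R :: 'n coeff_index cpoly. is_resultant d R then SOME R. is_resultant d R else 0)"


section \<open>Determinant and sign nonsingularity\<close>

(* The coefficient of x^a in the i-th component of tensor_apply k A x collects all entries
   A (i # js) in which every index j occurs exactly a j times in js. *)
definition tensor_coeff :: "nat \<Rightarrow> 'n::finite tensor \<Rightarrow> 'n coeff_index \<Rightarrow> complex" where
  "tensor_coeff k A =
     (\<lambda>(i, a). \<Sum>js | length js = k - 1 \<and> count_list js = a. of_real (A (i # js)))"

definition tensor_det :: "nat \<Rightarrow> 'n::finite tensor \<Rightarrow> complex" where
  "tensor_det k A = cpoly_eval (tensor_coeff k A) (resultant (k - 1))"

definition nonsingular :: "nat \<Rightarrow> 'n::finite tensor \<Rightarrow> bool" where
  "nonsingular k A \<longleftrightarrow> tensor_det k A \<noteq> 0"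

definition sign_class :: "nat \<Rightarrow> 'n tensor \<Rightarrow> 'n tensor set" where
  "sign_class k A = {B. \<forall>js. length js = k \<longrightarrow> sgn (B js) = sgn (A js)}"

definition sign_nonsingular :: "nat \<Rightarrow> 'n::finite tensor \<Rightarrow> bool" where
  "sign_nonsingular k A \<longleftrightarrow> (\<forall>B \<in> sign_class k A. nonsingular k B)"

lemma finite_exponents: "finite (exponents d :: ('n::finite \<Rightarrow> nat) set)"
proof (rule finite_subset)
  show "exponents d \<subseteq> (UNIV :: 'n set) \<rightarrow>\<^sub>E {..d}"
    unfolding exponents_def by (auto simp: PiE_def intro: member_le_sum)
qed (auto intro: finite_PiE)

lemma form_eval_tensor_coeff:
  fixes A :: "'n::finite tensor"
  shows "form_eval (k - 1) (tensor_coeff k A) i x = tensor_apply k A x $ i"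
proof -
  let ?S = "{js :: 'n list. length js = k - 1}"
  have fin: "finite ?S"
    using finite_lists_length_eq[of "UNIV :: 'n set" "k - 1"] by simp
  have cnt: "count_list ` ?S \<subseteq> exponents (k - 1)"
    using sum_count_set[of _ "UNIV :: 'n set"] by (auto simp: exponents_def)
  have pr: "(\<Prod>j\<leftarrow>js. x $ j) = (\<Prod>j\<in>UNIV. (x $ j) ^ count_list js j)" for js :: "'n list"
  proof (induction js)
    case (Cons a js)
    have "(\<Prod>j\<in>UNIV. (x $ j) ^ count_list (a # js) j) =
        (\<Prod>j\<in>UNIV. (if j = a then x $ j else 1) * (x $ j) ^ count_list js j)"
      by (rule prod.cong) auto
    also have "\<dots> = x $ a * (\<Prod>j\<in>UNIV. (x $ j) ^ count_list js j)"
      by (simp add: prod.distrib)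
    finally show ?case using Cons by simp
  qed simp
  have "form_eval (k - 1) (tensor_coeff k A) i x =
     (\<Sum>a\<in>exponents (k - 1). \<Sum>js | js \<in> ?S \<and> count_list js = a.
        of_real (A (i # js)) * (\<Prod>j\<leftarrow>js. x $ j))"
    unfolding form_eval_def tensor_coeff_def
    by (auto simp: sum_distrib_right pr intro!: sum.cong)
  also have "\<dots> = (\<Sum>js\<in>?S. of_real (A (i # js)) * (\<Prod>j\<leftarrow>js. x $ j))"
    by (rule sum.group[OF fin finite_exponents cnt])
  finally show ?thesis by (simp add: tensor_apply_def)
qed

lemma nonsingular_no_nonzero_solution:
  assumes "nonsingular k A" and "tensor_apply k A x = 0"
  shows "x = 0"
proof -
  let ?Ex = "\<exists>R. is_resultant (k - 1) (R :: 'a coeff_index cpoly)"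
  have ex: ?Ex
    using assms(1) by (auto simp: nonsingular_def tensor_det_def resultant_def cpoly_eval_def
        split: if_splits)
  then have "is_resultant (k - 1) (resultant (k - 1) :: 'a coeff_index cpoly)"
    unfolding resultant_def using someI_ex[OF ex] by simp
  then show ?thesis
    using assms unfolding is_resultant_def nonsingular_def tensor_det_def
    by (metis form_eval_tensor_coeff zero_index)
qed


section \<open>Ranks\<close>

(* Modes are counted from 1. *)
definition mode_fibers :: "nat \<Rightarrow> 'n::finite tensor \<Rightarrow> nat \<Rightarrow> (real ^ 'n) set" where
  "mode_fibers k A s =
     {(\<chi> t. A (js @ t # ls)) | js ls. length js = s - 1 \<and> length ls = k - s}"

definition mode_rank :: "nat \<Rightarrow> 'n::finite tensor \<Rightarrow> nat \<Rightarrow> nat" where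
  "mode_rank k A s = dim (span (mode_fibers k A s))"

definition multilinear_rank :: "nat \<Rightarrow> 'n::finite tensor \<Rightarrow> nat list" where
  "multilinear_rank k A = map (mode_rank k A) [1..<k + 1]"

(* The s-th factor (counted from 0) of the rank one tensor is \<alpha> s. *)
definition rank_one :: "nat \<Rightarrow> 'n::finite tensor \<Rightarrow> bool" where
  "rank_one k T \<longleftrightarrow>
     (\<exists>\<alpha> :: nat \<Rightarrow> real ^ 'n. (\<forall>s<k. \<alpha> s \<noteq> 0) \<and>
        (\<forall>js. length js = k \<longrightarrow> T js = (\<Prod>s<k. \<alpha> s $ (js ! s))))"

definition tensor_rank :: "nat \<Rightarrow> 'n::finite tensor \<Rightarrow> nat" where
  "tensor_rank k A =
     (LEAST r. \<exists>T :: nat \<Rightarrow> 'n tensor. (\<forall>l<r. rank_one k (T l)) \<and>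
        (\<forall>js. length js = k \<longrightarrow> A js = (\<Sum>l<r. T l js)))"

definition min_rank :: "nat \<Rightarrow> 'n::finite tensor \<Rightarrow> nat" where
  "min_rank k A = (INF B \<in> sign_class k A. tensor_rank k B)"

end

theory Submission
  imports Defs "HOL-Computational_Algebra.Fundamental_Theorem_Algebra"
begin

text \<open>
  A vector orthogonal to all mode-\<open>s\<close> fibers with \<open>s \<ge> 2\<close> is itself a zero of the system
  \<open>A x\<^sup>k\<^sup>-\<^sup>1 = 0\<close>. A vector orthogonal to all mode-1 fibers says that one of the \<open>n\<close> forms is a
  linear combination of the others, and \<open>n - 1\<close> forms in \<open>n\<close> variables always have a
  nontrivial complex zero. The latter follows from the mere existence of a resultant: if it did
  not vanish for forms \<open>f\<^sub>1, \<dots>, f\<^sub>n\<^sub>-\<^sub>1, 0\<close>, then it would vanish for no choice of the last form,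
  hence not depend on it, first for the given and then, deforming the forms along a line, for
  all \<open>f\<^sub>1, \<dots>, f\<^sub>n\<^sub>-\<^sub>1\<close>; but it distinguishes \<open>x\<^sub>n\<^sup>d\<close> from \<open>0\<close> when \<open>f\<^sub>i = x\<^sub>i\<^sup>d\<close>. The rank bound holds
  because a sum of \<open>r\<close> rank one tensors has mode-1 fibers in a span of \<open>r\<close> vectors.
\<close>

section \<open>Common zeros forced by the existence of a resultant\<close>

lemma cpoly_eval_line:
  assumes C: "\<And>z v. C z v = a v + z * b v"
  obtains q where "\<And>z. poly q z = cpoly_eval (C z) P"
proof
  let ?q = "\<Sum>m\<in>Poly_Mapping.keys P. [:Poly_Mapping.lookup P m:] *
    (\<Prod>v\<in>Poly_Mapping.keys m. [:a v, b v:] ^ Poly_Mapping.lookup m v)"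
  show "poly ?q z = cpoly_eval (C z) P" for z
    by (simp add: cpoly_eval_def poly_sum poly_prod poly_power C)
qed

lemma poly_eq_if_nonvanishing:
  fixes q :: "complex poly"
  assumes "\<And>z. poly q z \<noteq> 0"
  shows "poly q x = poly q y"
  using fundamental_theorem_of_algebra[of q] assms by (metis constant_def)

text \<open>The product \<open>r * (p - q)\<close> vanishes at every point, and complex polynomials
  form an integral domain.\<close>

lemma poly_eq_if_eq_where_nonzero:
  fixes p q r :: "complex poly"
  assumes "poly r a \<noteq> 0" and "\<And>z. poly r z \<noteq> 0 \<Longrightarrow> poly p z = poly q z"
  shows "p = q"
proof -
  have "poly (r * (p - q)) = poly 0"
    using assms(2) by (intro ext) auto
  then have "r * (p - q) = 0" by (simp only: poly_eq_poly_eq_iff)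
  then show ?thesis using assms(1) by auto
qed

lemma common_zero_if_row_zero:
  fixes c :: "'n::finite coeff_index \<Rightarrow> complex" and R :: "'n coeff_index cpoly"
  assumes R: "is_resultant d R" and d: "d > 0" and c0: "\<And>a. c (i0, a) = 0"
  obtains x where "x \<noteq> 0" "\<And>i. form_eval d c i x = 0"
proof -
  define u :: "'n coeff_index \<Rightarrow> complex"
    where "u = (\<lambda>(i, a). if a = (\<lambda>j. if j = i then d else 0) then 1 else 0)"
  \<comment> \<open>\<open>s\<close> moves the rows other than \<open>i0\<close> from
    \<open>c\<close> to the system \<open>u\<close> of pure powers, and \<open>t\<close> scales the
    pure power put into row \<open>i0\<close>. For fixed value of one parameter the other enters
    affinely, so \<open>cpoly_eval_line\<close> applies to each.\<close>
  define C where "C s t =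
    (\<lambda>v. if fst v = i0 then t * u v else c v + s * (u v - c v))" for s t
  have vanish: "cpoly_eval e R = 0 \<longleftrightarrow> (\<exists>x. x \<noteq> 0 \<and> (\<forall>i. form_eval d e i x = 0))" for e
    using R by (simp add: is_resultant_def)
  have u1: "cpoly_eval u R = 1"
    using R by (simp add: is_resultant_def u_def)
  have C11: "C 1 1 = u" by (auto simp: C_def)
  have C00: "C 0 0 = c" using c0 by (auto simp: C_def)
  have C10: "cpoly_eval (C 1 0) R = 0"
  proof -
    \<comment> \<open>Row \<open>i0\<close> is zero here, and the pure powers of the other variables
      vanish at \<open>axis i0 1\<close> because \<open>d > 0\<close>.\<close>
    have "form_eval d (C 1 0) i (axis i0 1) = 0" for i
      unfolding form_eval_def
    proof (rule sum.neutral, rule ballI)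
      fix a :: "'n \<Rightarrow> nat"
      have "(\<Prod>j\<in>UNIV. (axis i0 1 $ j :: complex) ^ (if j = i then d else 0)) = 0" if "i \<noteq> i0"
        using that d by (intro prod_zero) (auto simp: axis_def intro!: exI[of _ i])
      then show "C 1 0 (i, a) * (\<Prod>j\<in>UNIV. axis i0 1 $ j ^ a j) = 0"
        by (auto simp: C_def u_def)
    qed
    then show ?thesis
      unfolding vanish by (intro exI[of _ "axis i0 1"]) auto
  qed
  \<comment> \<open>Row \<open>i0\<close> of \<open>C s 0\<close> is the zero form, so every common
    zero of \<open>C s t\<close> is also one of \<open>C s 0\<close>.\<close>
  have mono: "cpoly_eval (C s t) R \<noteq> 0" if "cpoly_eval (C s 0) R \<noteq> 0" for s t
  proof
    assume "cpoly_eval (C s t) R = 0"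
    then obtain x where x: "x \<noteq> 0" "\<And>i. form_eval d (C s t) i x = 0"
      unfolding vanish by blast
    have "form_eval d (C s 0) i x = 0" for i
      using x(2)[of i] by (cases "i = i0") (auto simp: form_eval_def C_def)
    with x(1) have "cpoly_eval (C s 0) R = 0" unfolding vanish by blast
    then show False using that by contradiction
  qed
  have const: "cpoly_eval (C s 1) R = cpoly_eval (C s 0) R"
    if "cpoly_eval (C s 0) R \<noteq> 0" for s
  proof -
    obtain q where q: "\<And>t. poly q t = cpoly_eval (C s t) R"
      by (rule cpoly_eval_line[of "C s" "C s 0" "\<lambda>v. if fst v = i0 then u v else 0"])
        (auto simp: C_def)
    show ?thesis using poly_eq_if_nonvanishing[of q 1 0] mono[OF that] by (simp add: q)
  qed
  have line: "\<exists>q. \<forall>s. poly q s = cpoly_eval (C s t) R" for t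
  proof -
    obtain q where "\<And>s. poly q s = cpoly_eval (C s t) R"
      by (rule cpoly_eval_line[of "\<lambda>s. C s t" "C 0 t"
            "\<lambda>v. if fst v = i0 then 0 else u v - c v"]) (auto simp: C_def)
    then show ?thesis by blast
  qed
  obtain p where p: "\<And>s. poly p s = cpoly_eval (C s 0) R" using line[of 0] by blast
  obtain q where q: "\<And>s. poly q s = cpoly_eval (C s 1) R" using line[of 1] by blast
  have "cpoly_eval c R = 0"
  proof (rule ccontr)
    assume "cpoly_eval c R \<noteq> 0"
    \<comment> \<open>The polynomials agree wherever \<open>p\<close> is nonzero, and
      \<open>p\<close> is nonzero at 0. Yet at 1 they take the values 0 and 1.\<close>
    then have "q = p"
      using const by (intro poly_eq_if_eq_where_nonzero[of p 0]) (auto simp: p q C00)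
    then show False using p[of 1] q[of 1] C10 C11 u1 by simp
  qed
  then show thesis unfolding vanish using that by blast
qed

text \<open>Otherwise \<open>resultant\<close> would take its default value 0, and every determinant
  would be 0.\<close>

lemma nonsingular_imp_is_resultant:
  fixes A :: "'n::finite tensor"
  assumes "nonsingular k A"
  obtains R :: "'n coeff_index cpoly" where "is_resultant (k - 1) R"
  using assms that
  by (auto simp: nonsingular_def tensor_det_def resultant_def cpoly_eval_def split: if_splits)

text \<open>Drop a form whose weight in the dependency \<open>v\<close> is nonzero. The remaining
  forms have a nontrivial common zero, and the dependency makes the dropped form vanish there
  too.\<close>

lemma nonsingular_no_dependent_rows:
  fixes A :: "'n::finite tensor" and v :: "real ^ 'n"
  assumes k: "k \<ge> 2" and ns: "nonsingular k A"
    and dep: "\<And>js. length js = k - 1 \<Longrightarrow> (\<Sum>i\<in>UNIV. v $ i * A (i # js)) = 0"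
  shows "v = 0"
proof (rule ccontr)
  assume "v \<noteq> 0"
  then obtain i0 where i0: "v $ i0 \<noteq> 0" by (auto simp: vec_eq_iff)
  obtain R :: "'n coeff_index cpoly" where R: "is_resultant (k - 1) R"
    using nonsingular_imp_is_resultant[OF ns] .
  define c where "c = (\<lambda>(i, a). if i = i0 then 0 else tensor_coeff k A (i, a))"
  obtain x where x: "x \<noteq> 0" "\<And>i. form_eval (k - 1) c i x = 0"
    using common_zero_if_row_zero[OF R, of c i0] k by (auto simp: c_def)
  have other: "tensor_apply k A x $ i = 0" if "i \<noteq> i0" for i
    using x(2)[of i] that unfolding form_eval_tensor_coeff[symmetric]
    by (simp add: c_def form_eval_def)
  have "(\<Sum>i\<in>UNIV. of_real (v $ i) * tensor_apply k A x $ i) =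
      (\<Sum>js | length js = k - 1. \<Sum>i\<in>UNIV.
         of_real (v $ i) * (of_real (A (i # js)) * (\<Prod>j\<leftarrow>js. x $ j)))"
    unfolding tensor_apply_def by (simp add: sum_distrib_left) (rule sum.swap)
  also have "\<dots> = (\<Sum>js | length js = k - 1.
      of_real (\<Sum>i\<in>UNIV. v $ i * A (i # js)) * (\<Prod>j\<leftarrow>js. x $ j))"
    by (simp add: sum_distrib_right mult.assoc)
  also have "\<dots> = 0" using dep by (intro sum.neutral) simp
  finally have "of_real (v $ i0) * tensor_apply k A x $ i0 = 0"
    using other by (subst (asm) sum.remove[of _ i0]) auto
  then have "tensor_apply k A x $ i = 0" for i
    using other i0 by (cases "i = i0") auto
  then have "tensor_apply k A x = 0" by (simp add: vec_eq_iff)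
  then show False using nonsingular_no_nonzero_solution[OF ns] x(1) by blast
qed

section \<open>Multilinear rank of nonsingular tensors\<close>

lemma sum_lists_split_at:
  fixes f :: "'n::finite list \<Rightarrow> 'b::comm_monoid_add"
  assumes "m < l"
  shows "(\<Sum>js | length js = l. f js) =
    (\<Sum>(ps, qs) \<in> {ps. length ps = m} \<times> {qs. length qs = l - Suc m}. \<Sum>t\<in>UNIV. f (ps @ t # qs))"
proof -
  have "(\<Sum>js | length js = l. f js) =
    (\<Sum>((ps, qs), t) \<in> ({ps. length ps = m} \<times> {qs. length qs = l - Suc m}) \<times> UNIV. f (ps @ t # qs))"
    by (rule sum.reindex_bij_witness[of _ "\<lambda>((ps, qs), t). ps @ t # qs"
          "\<lambda>js. ((take m js, drop (Suc m) js), js ! m)"])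
       (use assms in \<open>auto simp: id_take_nth_drop[symmetric]\<close>)
  then show ?thesis by (simp add: sum.cartesian_product case_prod_unfold)
qed

lemma tensor_apply_eq_0_if_orthogonal:
  fixes A :: "'n::finite tensor" and v :: "real ^ 'n"
  assumes s: "2 \<le> s" "s \<le> k"
    and orth: "\<And>js ls. length js = s - 1 \<Longrightarrow> length ls = k - s \<Longrightarrow>
      (\<Sum>t\<in>UNIV. v $ t * A (js @ t # ls)) = 0"
  shows "tensor_apply k A (\<chi> i. of_real (v $ i)) = 0"
proof -
  define x :: "complex ^ 'n" where "x = (\<chi> i. of_real (v $ i))"
  have xv: "x $ i = of_real (v $ i)" for i by (simp add: x_def)
  have inner: "(\<Sum>t\<in>UNIV. of_real (A (i # ps @ t # qs)) * (\<Prod>j\<leftarrow>ps @ t # qs. x $ j)) = 0"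
    if "length ps = s - 2" "length qs = k - s" for i ps qs
  proof -
    have "(\<Sum>t\<in>UNIV. of_real (A (i # ps @ t # qs)) * (\<Prod>j\<leftarrow>ps @ t # qs. x $ j)) =
      of_real (\<Sum>t\<in>UNIV. v $ t * A ((i # ps) @ t # qs)) *
        ((\<Prod>j\<leftarrow>ps. x $ j) * (\<Prod>j\<leftarrow>qs. x $ j))"
      unfolding of_real_sum sum_distrib_right
      by (intro sum.cong) (simp_all add: xv[symmetric] mult_ac)
    also have "\<dots> = 0"
      using that s by (subst orth) auto
    finally show ?thesis .
  qed
  \<comment> \<open>The first index of \<open>A\<close> is the free index \<open>i\<close>, so mode
    \<open>s\<close>, counted from 1, is position \<open>s - 2\<close>, counted from 0, of the
    summed list.\<close>
  have "s - 2 < k - 1" and len: "k - 1 - Suc (s - 2) = k - s" using s by auto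
  then have "tensor_apply k A x $ i = 0" for i
    unfolding tensor_apply_def vec_lambda_beta sum_lists_split_at[OF \<open>s - 2 < k - 1\<close>] len
    using inner by (intro sum.neutral) (auto simp only: mem_Times_iff mem_Collect_eq split: prod.split)
  then show ?thesis by (simp add: vec_eq_iff x_def)
qed

lemma mode_rank_nonsingular:
  fixes A :: "'n::finite tensor"
  assumes k: "k \<ge> 2" and ns: "nonsingular k A" and s: "1 \<le> s" "s \<le> k"
  shows "mode_rank k A s = CARD('n)"
proof (rule ccontr)
  assume "mode_rank k A s \<noteq> CARD('n)"
  moreover have "mode_rank k A s \<le> CARD('n)"
    using dim_subset_UNIV[of "span (mode_fibers k A s)"] by (simp add: mode_rank_def)
  ultimately have "dim (mode_fibers k A s) < DIM(real ^ 'n)"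
    by (simp add: mode_rank_def)
  then obtain v where v: "v \<noteq> 0" "\<And>y. y \<in> span (mode_fibers k A s) \<Longrightarrow> orthogonal v y"
    using orthogonal_to_subspace_exists by blast
  have orth: "(\<Sum>t\<in>UNIV. v $ t * A (js @ t # ls)) = 0"
    if "length js = s - 1" "length ls = k - s" for js ls
  proof -
    have "(\<chi> t. A (js @ t # ls)) \<in> span (mode_fibers k A s)"
      using that by (intro span_base) (auto simp: mode_fibers_def)
    from v(2)[OF this] show ?thesis by (simp add: orthogonal_def inner_vec_def)
  qed
  show False
  \<comment> \<open>Mode 1 numbers the equations, so \<open>v\<close> is a linear dependency between
    them. Any other mode numbers variables, so \<open>v\<close> itself solves the system.\<close>
  proof (cases "s = 1")
    case True
    then show False
      using nonsingular_no_dependent_rows[OF k ns, of v] orth[of "[]"] v(1) by auto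
  next
    case False
    then have "tensor_apply k A (\<chi> i. of_real (v $ i)) = 0"
      using s orth by (intro tensor_apply_eq_0_if_orthogonal[of s]) auto
    then show False
      using nonsingular_no_nonzero_solution[OF ns] v(1) by (force simp: vec_eq_iff)
  qed
qed

section \<open>Lower bound for the tensor rank\<close>

lemma mode_rank_le_rank_one_terms:
  fixes A :: "'n::finite tensor" and T :: "nat \<Rightarrow> 'n tensor"
  assumes k: "k > 0" and T: "\<And>l. l < r \<Longrightarrow> rank_one k (T l)"
    and A: "\<And>js. length js = k \<Longrightarrow> A js = (\<Sum>l<r. T l js)"
  shows "mode_rank k A 1 \<le> r"
proof -
  obtain \<alpha> :: "nat \<Rightarrow> nat \<Rightarrow> real ^ 'n"
    where \<alpha>: "T l js = (\<Prod>s<k. \<alpha> l s $ (js ! s))" if "l < r" "length js = k" for l js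
    using T unfolding rank_one_def by metis
  let ?S = "(\<lambda>l. \<alpha> l 0) ` {..<r}"
  obtain k' where k': "k = Suc k'" using k by (cases k) auto
  have "mode_fibers k A 1 \<subseteq> span ?S"
  proof
    fix y assume "y \<in> mode_fibers k A 1"
    then obtain ls where ls: "length ls = k'" and y: "y = (\<chi> t. A (t # ls))"
      by (auto simp: mode_fibers_def k')
    \<comment> \<open>Fixing all indices but the first turns each rank one term into a multiple of
      its first factor.\<close>
    have "y = (\<Sum>l<r. (\<Prod>s<k'. \<alpha> l (Suc s) $ (ls ! s)) *\<^sub>R \<alpha> l 0)"
      using ls by (auto simp: y vec_eq_iff A k' \<alpha> prod.lessThan_Suc_shift mult.commute
          simp del: prod.lessThan_Suc intro!: sum.cong)
    also have "\<dots> \<in> span ?S"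
      by (intro span_sum span_scale span_base) auto
    finally show "y \<in> span ?S" .
  qed
  then have "dim (mode_fibers k A 1) \<le> card ?S" by (rule dim_le_card) simp
  also have "\<dots> \<le> r" using card_image_le[of "{..<r}"] by simp
  finally show ?thesis by (simp add: mode_rank_def)
qed

text \<open>Each nonzero entry alone gives a rank one tensor. This ensures that the
  \<open>LEAST\<close> in \<open>tensor_rank\<close> is attained.\<close>

lemma rank_one_decomposition_exists:
  fixes A :: "'n::finite tensor"
  assumes k: "k > 0"
  shows "\<exists>r. \<exists>T :: nat \<Rightarrow> 'n tensor. (\<forall>l<r. rank_one k (T l)) \<and>
    (\<forall>js. length js = k \<longrightarrow> A js = (\<Sum>l<r. T l js))"
proof -
  let ?S = "{is :: 'n list. length is = k \<and> A is \<noteq> 0}"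
  have fin: "finite ?S"
    using finite_lists_length_eq[of "UNIV :: 'n set" k] by simp
  obtain h where h: "bij_betw h {..<card ?S} ?S"
    using ex_bij_betw_nat_finite[OF fin] by (auto simp: atLeast0LessThan)
  define T where "T l js = (if js = h l then A js else 0)" for l js
  have "rank_one k (T l)" if "l < card ?S" for l
  proof -
    have hl: "length (h l) = k" "A (h l) \<noteq> 0"
      using bij_betwE[OF h] that by auto
    \<comment> \<open>The factors are unit vectors at the position of the entry; the first one,
      present since \<open>k > 0\<close>, carries its nonzero value.\<close>
    define \<alpha> :: "nat \<Rightarrow> real ^ 'n"
      where "\<alpha> s = axis (h l ! s) (if s = 0 then A (h l) else 1)" for s
    have "T l js = (\<Prod>s<k. \<alpha> s $ (js ! s))" if js: "length js = k" for js
    proof (cases "js = h l")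
      case True
      then show ?thesis using k
        by (cases k) (simp_all add: T_def \<alpha>_def prod.lessThan_Suc_shift
            del: prod.lessThan_Suc)
    next
      case False
      then obtain s where "s < k" "js ! s \<noteq> h l ! s"
        using js hl by (auto simp: list_eq_iff_nth_eq)
      then have "(\<Prod>s<k. \<alpha> s $ (js ! s)) = 0"
        by (intro prod_zero bexI[of _ s]) (auto simp: \<alpha>_def axis_def)
      then show ?thesis using False by (simp add: T_def)
    qed
    moreover have "\<alpha> s \<noteq> 0" for s using hl by (simp add: \<alpha>_def axis_eq_0_iff)
    ultimately show ?thesis unfolding rank_one_def by blast
  qed
  moreover have "A js = (\<Sum>l<card ?S. T l js)" if js: "length js = k" for js
  proof -
    have "(\<Sum>l<card ?S. T l js) = (\<Sum>is\<in>?S. if js = is then A js else 0)"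
      unfolding T_def by (rule sum.reindex_bij_betw[OF h])
    also have "\<dots> = A js" using fin js by simp
    finally show ?thesis by simp
  qed
  ultimately show ?thesis by blast
qed

lemma mode_rank_le_tensor_rank:
  fixes A :: "'n::finite tensor"
  assumes "k > 0"
  shows "mode_rank k A 1 \<le> tensor_rank k A"
  using LeastI_ex[OF rank_one_decomposition_exists[OF assms, of A]]
    mode_rank_le_rank_one_terms[OF assms] unfolding tensor_rank_def by blast

theorem theorem4p1:
  fixes A :: "'n::finite tensor" and k :: nat
  assumes "k \<ge> 2" and "sign_nonsingular k A"
  shows "(\<forall>B \<in> sign_class k A. multilinear_rank k B = replicate k CARD('n)) \<and>
         min_rank k A \<ge> CARD('n)"
proof -
  have full: "mode_rank k B s = CARD('n)"
    if "B \<in> sign_class k A" "1 \<le> s" "s \<le> k" for B s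
    using that assms by (intro mode_rank_nonsingular) (auto simp: sign_nonsingular_def)
  have "multilinear_rank k B = replicate k CARD('n)" if "B \<in> sign_class k A" for B
    using full[OF that] by (auto simp: multilinear_rank_def list_eq_iff_nth_eq nth_append
        simp del: upt_Suc)
  moreover have "CARD('n) \<le> tensor_rank k B" if "B \<in> sign_class k A" for B
    using full[OF that, of 1] mode_rank_le_tensor_rank[of k B] assms(1) by simp
  \<comment> \<open>The infimum in \<open>min_rank\<close> is thus over a nonempty set, as
    \<open>cINF_greatest\<close> requires.\<close>
  moreover have "A \<in> sign_class k A" by (simp add: sign_class_def)
  ultimately show ?thesis
    unfolding min_rank_def by (auto intro!: cINF_greatest)
qed

end
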